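(* Let $G$ be a finite simple graph without isolated vertices. If $\gamma_{Zg}(G)$ is an even number, then $\gamma_{Zg}(G)+1\le\gamma_{Lg}(G)$.
   Context: Graphs are finite and simple (and nonempty). $N(v)$ and $N[v]=N(v)\cup\{v\}$ denote the open and closed neighborhood of a vertex $v$. Games: two players, Dominator and Staller, alternately select vertices $v_1,v_2,\ldots$ of an isolate-free graph $G$. The $i$-th move $v_i$ is legal: - in the Z-domination game, if $N(v_i)\setminus\bigcup_{j=1}^{i-1}N[v_j]\neq\emptyset$; - in the L-domination game, if $N[v_i]\setminus\bigcup_{j=1}^{i-1}N(v_j)\neq\emptyset$ and $v_i\neq v_j$ for all $j<i$. Each game ends when no legal move is available. Dominator wants to minimize the total number of moves, Staller wants to maximize it. When Dominator moves first and both players play optimally, the total number of moves played (by both players) is $\gamma_{Zg}(G)$ in the Z-domination game and $\gamma_{Lg}(G)$ in the L-domination game. *)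

theory Defs
  imports "Graph_Theory.Pair_Digraph"
begin

text \<open>
  A finite simple graph is a \<^locale>\<open>pair_graph\<close>: finitely many vertices and a symmetric,
  loop-free set of arcs, where the edge \<open>uv\<close> appears as the two arcs \<open>(u, v)\<close> and \<open>(v, u)\<close>.
\<close>

definition open_nbhd :: "'a pair_pre_digraph \<Rightarrow> 'a \<Rightarrow> 'a set" where
  "open_nbhd G v = {u. (v, u) \<in> parcs G}"

definition closed_nbhd :: "'a pair_pre_digraph \<Rightarrow> 'a \<Rightarrow> 'a set" where
  "closed_nbhd G v = insert v (open_nbhd G v)"

definition isolate_free :: "'a pair_pre_digraph \<Rightarrow> bool" where
  "isolate_free G \<longleftrightarrow> (\<forall>v\<in>pverts G. open_nbhd G v \<noteq> {})"


section \<open>Length of a game under optimal play\<close>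

datatype player = Dominator | Staller

text \<open>
  A position of a game is the list of the moves played so far, oldest first, and \<open>moves h\<close> is the
  set of legal moves in position \<open>h\<close>. The assumption that no vertex can be played twice is there
  to guarantee that every play is finite; it is proved for both games below.
\<close>

locale vertex_game =
  fixes V :: "'a set" and moves :: "'a list \<Rightarrow> 'a set"
  assumes finite_V: "finite V"
    and moves_subset: "moves h \<subseteq> V - set h"
begin

text \<open>
  \<open>moves_left p h\<close> is the number of moves, of both players together, that are still made from
  position \<open>h\<close> with player \<open>p\<close> to move when both players play optimally.
\<close>

function moves_left :: "player \<Rightarrow> 'a list \<Rightarrow> nat" where
  "moves_left Dominator h =
    (if moves h = {} then 0 else 1 + Min ((\<lambda>v. moves_left Staller (h @ [v])) ` moves h))"
| "moves_left Staller h =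
    (if moves h = {} then 0 else 1 + Max ((\<lambda>v. moves_left Dominator (h @ [v])) ` moves h))"
  by pat_completeness auto

lemma card_unplayed_less:
  assumes "v \<in> moves h"
  shows "card (V - set (h @ [v])) < card (V - set h)"
proof (rule psubset_card_mono)
  show "finite (V - set h)" using finite_V by simp
  show "V - set (h @ [v]) \<subset> V - set h" using assms moves_subset[of h] by auto
qed

termination
  by (relation "measure (\<lambda>(p, h). card (V - set h))") (use card_unplayed_less in auto)

end


section \<open>The Z-domination and the L-domination game\<close>

definition Z_moves :: "'a pair_pre_digraph \<Rightarrow> 'a list \<Rightarrow> 'a set" where
  "Z_moves G h = {v \<in> pverts G. open_nbhd G v - (\<Union>u\<in>set h. closed_nbhd G u) \<noteq> {}}"

definition L_moves :: "'a pair_pre_digraph \<Rightarrow> 'a list \<Rightarrow> 'a set" where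
  "L_moves G h =
    {v \<in> pverts G. closed_nbhd G v - (\<Union>u\<in>set h. open_nbhd G u) \<noteq> {} \<and> v \<notin> set h}"

lemma vertex_game_Z: "pair_graph G \<Longrightarrow> vertex_game (pverts G) (Z_moves G)"
  by unfold_locales
    (auto simp: Z_moves_def closed_nbhd_def intro: pair_fin_digraph.pair_finite_verts
       pair_digraph.axioms(1) pair_graph.axioms(1))

lemma vertex_game_L: "pair_graph G \<Longrightarrow> vertex_game (pverts G) (L_moves G)"
  by unfold_locales
    (auto simp: L_moves_def intro: pair_fin_digraph.pair_finite_verts
       pair_digraph.axioms(1) pair_graph.axioms(1))

definition gamma_Zg :: "'a pair_pre_digraph \<Rightarrow> nat" where
  "gamma_Zg G = vertex_game.moves_left (Z_moves G) Dominator []"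

definition gamma_Lg :: "'a pair_pre_digraph \<Rightarrow> nat" where
  "gamma_Lg G = vertex_game.moves_left (L_moves G) Dominator []"

lemmas Z_moves_left_simps = vertex_game.moves_left.simps[OF vertex_game_Z]
lemmas L_moves_left_simps = vertex_game.moves_left.simps[OF vertex_game_L]

end

theory Submission
  imports Defs
begin

text \<open>
  Dominator plays the Z-game while imagining an L-game, keeping every vertex closed-dominated by the
  L-moves also closed-dominated by the Z-moves. Every Z-move of Staller is then legal in the L-game
  and is copied there; an optimal L-move \<open>v\<close> of Dominator is copied if it is legal in the
  Z-game, and is otherwise replaced by a neighbour of \<open>v\<close> or, if \<open>v\<close> is already dominated, by any
  legal move. Hence the Z-game ends no later than the L-game. If the L-game is at
  a position where a single move of Staller must end it, then the Z-game is over already: a vertex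
  undominated in the Z-game would be a legal L-move that does not totally dominate itself. So
  if Staller makes the last move of the L-game, then the Z-game is strictly shorter.
\<close>

context vertex_game
begin

lemma finite_moves [simp]: "finite (moves h)"
  using moves_subset[of h] finite_V by (meson finite_Diff finite_subset)

declare moves_left.simps [simp del]

lemma moves_left_Dominator_nonempty:
  assumes "moves h \<noteq> {}"
  shows "moves_left Dominator h = Suc (Min ((\<lambda>v. moves_left Staller (h @ [v])) ` moves h))"
  unfolding moves_left.simps(1)[of h] using assms by (simp only: if_False plus_1_eq_Suc)

lemma moves_left_Staller_nonempty:
  assumes "moves h \<noteq> {}"
  shows "moves_left Staller h = Suc (Max ((\<lambda>v. moves_left Dominator (h @ [v])) ` moves h))"
  unfolding moves_left.simps(2)[of h] using assms by (simp only: if_False plus_1_eq_Suc)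

lemma moves_left_eq_0_iff: "moves_left p h = 0 \<longleftrightarrow> moves h = {}"
proof (cases "moves h = {}")
  case True
  then show ?thesis by (cases p) (simp_all add: moves_left.simps)
next
  case False
  then show ?thesis
    by (cases p) (simp_all add: moves_left_Dominator_nonempty moves_left_Staller_nonempty)
qed

lemma moves_left_Dominator_le:
  assumes "v \<in> moves h"
  shows "moves_left Dominator h \<le> Suc (moves_left Staller (h @ [v]))"
proof -
  have "moves h \<noteq> {}" using assms by blast
  then show ?thesis using assms by (simp add: moves_left_Dominator_nonempty)
qed

lemma moves_left_Staller_ge:
  assumes "v \<in> moves h"
  shows "Suc (moves_left Dominator (h @ [v])) \<le> moves_left Staller h"
proof -
  have "moves h \<noteq> {}" using assms by blast
  then show ?thesis using assms by (simp add: moves_left_Staller_nonempty)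
qed

lemma optimal_Dominator_move:
  assumes "moves h \<noteq> {}"
  obtains v where "v \<in> moves h" "moves_left Dominator h = Suc (moves_left Staller (h @ [v]))"
proof -
  have "Min ((\<lambda>v. moves_left Staller (h @ [v])) ` moves h) \<in> (\<lambda>v. moves_left Staller (h @ [v])) ` moves h"
    using assms by (intro Min_in) auto
  then show thesis using that moves_left_Dominator_nonempty[OF assms] by auto
qed

lemma optimal_Staller_move:
  assumes "moves h \<noteq> {}"
  obtains v where "v \<in> moves h" "moves_left Staller h = Suc (moves_left Dominator (h @ [v]))"
proof -
  have "Max ((\<lambda>v. moves_left Dominator (h @ [v])) ` moves h) \<in> (\<lambda>v. moves_left Dominator (h @ [v])) ` moves h"
    using assms by (intro Max_in) auto
  then show thesis using that moves_left_Staller_nonempty[OF assms] by auto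
qed

end

definition dominated :: "'a pair_pre_digraph \<Rightarrow> 'a list \<Rightarrow> 'a set" where
  "dominated G h = (\<Union>u\<in>set h. closed_nbhd G u)"

lemma dominated_snoc [simp]: "dominated G (h @ [v]) = dominated G h \<union> closed_nbhd G v"
  by (auto simp: dominated_def)

lemma in_Z_moves_iff:
  "v \<in> Z_moves G g \<longleftrightarrow> v \<in> pverts G \<and> \<not> open_nbhd G v \<subseteq> dominated G g"
  by (auto simp: Z_moves_def dominated_def)

lemma undominated_in_L_moves:
  assumes "u \<in> pverts G" "u \<notin> dominated G h"
  shows "u \<in> L_moves G h"
  using assms by (auto simp: L_moves_def dominated_def closed_nbhd_def)

text \<open>A neighbour \<open>u\<close> of \<open>v\<close> undominated in \<open>g\<close> is
  undominated in \<open>h\<close>. It lies in no open neighbourhood of a vertex of \<open>h\<close>,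
  so it witnesses the L-move, and it shows that \<open>v\<close> is not in \<open>h\<close>.\<close>

lemma Z_moves_subset_L_moves:
  assumes "dominated G h \<subseteq> dominated G g"
  shows "Z_moves G g \<subseteq> L_moves G h"
  using assms by (auto simp: in_Z_moves_iff L_moves_def dominated_def closed_nbhd_def) blast+

lemma open_nbhd_sym:
  assumes "pair_graph G" "u \<in> open_nbhd G v"
  shows "v \<in> open_nbhd G u"
proof -
  interpret pair_graph G by fact
  show ?thesis using assms(2) arcs_symmetric by (simp add: open_nbhd_def)
qed

lemma open_nbhd_subset_pverts:
  assumes "pair_graph G"
  shows "open_nbhd G v \<subseteq> pverts G"
proof -
  interpret pair_graph G by fact
  show ?thesis using in_arcsD2 by (auto simp: open_nbhd_def)
qed

lemma not_in_open_nbhd_self: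
  assumes "pair_graph G"
  shows "v \<notin> open_nbhd G v"
proof -
  interpret pair_graph G by fact
  show ?thesis using no_loops by (fastforce simp: open_nbhd_def)
qed

context
  fixes G :: "'a pair_pre_digraph"
  assumes graph: "pair_graph G" and isolate_free: "isolate_free G"
begin

interpretation Z: vertex_game "pverts G" "Z_moves G"
  using graph by (rule vertex_game_Z)

interpretation L: vertex_game "pverts G" "L_moves G"
  using graph by (rule vertex_game_L)

lemma neighbour_exists:
  assumes "v \<in> pverts G"
  obtains w where "w \<in> pverts G" "w \<in> open_nbhd G v" "v \<in> open_nbhd G w"
  using assms isolate_free open_nbhd_subset_pverts[OF graph] open_nbhd_sym[OF graph]
  unfolding isolate_free_def by blast

lemma undominated_exists:
  assumes "Z_moves G g \<noteq> {}"
  obtains u where "u \<in> pverts G" "u \<notin> dominated G g"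
  using assms open_nbhd_subset_pverts[OF graph] by (auto simp: in_Z_moves_iff) blast

text \<open>The move \<open>u\<close> does not totally dominate \<open>u\<close>, so any neighbour
  \<open>w\<close> of \<open>u\<close> can still be played. It has not been played before, as
  \<open>u\<close> would then be dominated.\<close>

lemma L_moves_after_undominated:
  assumes "u \<in> pverts G" "u \<notin> dominated G h"
  shows "L_moves G (h @ [u]) \<noteq> {}"
proof -
  obtain w where w: "w \<in> pverts G" "w \<in> open_nbhd G u" "u \<in> open_nbhd G w"
    using assms(1) by (rule neighbour_exists)
  have "w \<notin> set (h @ [u])" and "u \<notin> (\<Union>x\<in>set (h @ [u]). open_nbhd G x)"
    using w assms(2) not_in_open_nbhd_self[OF graph] by (auto simp: dominated_def closed_nbhd_def)
  then have "w \<in> L_moves G (h @ [u])"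
    using w by (auto simp: L_moves_def closed_nbhd_def)
  then show ?thesis by blast
qed

lemma Dominator_reply_exists:
  assumes "Z_moves G g \<noteq> {}" "dominated G h \<subseteq> dominated G g" "v \<in> pverts G"
  obtains w where "w \<in> Z_moves G g" "dominated G (h @ [v]) \<subseteq> dominated G (g @ [w])"
proof (cases "v \<in> Z_moves G g")
  case True
  then show ?thesis using that assms(2) by fastforce
next
  case False
  \<comment> \<open>Of the closed neighbourhood of \<open>v\<close>, only \<open>v\<close> itself
    can still be missing.\<close>
  then have nbhd: "open_nbhd G v \<subseteq> dominated G g"
    using assms(3) by (simp add: in_Z_moves_iff)
  show ?thesis
  proof (cases "v \<in> dominated G g")
    case True
    obtain w where "w \<in> Z_moves G g" using assms(1) by blast
    then show ?thesis using that[of w] True nbhd assms(2) by (auto simp: closed_nbhd_def)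
  next
    case False
    \<comment> \<open>The undominated \<open>v\<close> makes its neighbour \<open>w\<close> legal in
      the Z-game, and \<open>w\<close> dominates \<open>v\<close>.\<close>
    obtain w where "w \<in> pverts G" "v \<in> open_nbhd G w"
      using assms(3) by (rule neighbour_exists)
    then show ?thesis
      using that[of w] False nbhd assms(2) by (auto simp: in_Z_moves_iff closed_nbhd_def)
  qed
qed

text \<open>
  The bounds are \<open>a\<close> rounded down to an odd and to an even number, except that \<open>0\<close> stays \<open>0\<close> by
  truncated subtraction.
\<close>

lemma Z_moves_left_le:
  assumes "dominated G h \<subseteq> dominated G g"
  shows "Z.moves_left Dominator g \<le> 2 * ((L.moves_left Dominator h + 1) div 2) - 1"
    and "Z.moves_left Staller g \<le> 2 * (L.moves_left Staller h div 2)"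
proof -
  \<comment> \<open>Each bound rests on the other one after one more move, so both go through a
    single induction on the number of L-moves left.\<close>
  have "(L.moves_left Dominator h = a \<longrightarrow> Z.moves_left Dominator g \<le> 2 * ((a + 1) div 2) - 1) \<and>
        (L.moves_left Staller h = a \<longrightarrow> Z.moves_left Staller g \<le> 2 * (a div 2))" for a
    using assms
  proof (induction a arbitrary: h g rule: less_induct)
    case (less a)
    show ?case
    proof (cases "Z_moves G g = {}")
      case True
      then have "Z.moves_left p g = 0" for p by (simp add: Z.moves_left_eq_0_iff)
      then show ?thesis by simp
    next
      case nonempty: False
      then have L_nonempty: "L_moves G h \<noteq> {}"
        using Z_moves_subset_L_moves[OF less.prems] by blast
      have "Z.moves_left Dominator g \<le> 2 * ((a + 1) div 2) - 1" if a: "L.moves_left Dominator h = a"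
      proof -
        obtain v where v: "v \<in> L_moves G h" "a = Suc (L.moves_left Staller (h @ [v]))"
          using L.optimal_Dominator_move[OF L_nonempty] a by metis
        then obtain w where w: "w \<in> Z_moves G g" "dominated G (h @ [v]) \<subseteq> dominated G (g @ [w])"
          using Dominator_reply_exists[OF nonempty less.prems] L.moves_subset by blast
        have "Z.moves_left Staller (g @ [w]) \<le> 2 * ((a - 1) div 2)"
          using less.IH[OF _ w(2), of "a - 1"] v(2) by simp
        with Z.moves_left_Dominator_le[OF w(1)] v(2) show ?thesis by simp
      qed
      moreover have "Z.moves_left Staller g \<le> 2 * (a div 2)" if a: "L.moves_left Staller h = a"
      proof -
        \<comment> \<open>The vertex \<open>u\<close> serves only to show that the L-game can last
          two more moves; the copied move is the \<open>v\<close> chosen below.\<close>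
        obtain u where "u \<in> pverts G" "u \<notin> dominated G g"
          using nonempty by (rule undominated_exists)
        then have u: "u \<in> pverts G" "u \<notin> dominated G h" using less.prems by blast+
        have "L.moves_left Dominator (h @ [u]) \<noteq> 0"
          using L_moves_after_undominated[OF u] L.moves_left_eq_0_iff by simp
        then have "a \<ge> 2"
          using L.moves_left_Staller_ge[OF undominated_in_L_moves[OF u]] a by simp
        obtain v where v: "v \<in> Z_moves G g"
            "Z.moves_left Staller g = Suc (Z.moves_left Dominator (g @ [v]))"
          using nonempty by (rule Z.optimal_Staller_move)
        define b where "b = L.moves_left Dominator (h @ [v])"
        \<comment> \<open>Only an inequality: \<open>v\<close> is optimal in the Z-game but perhaps
          not in the L-game.\<close>
        have "b < a"
          using L.moves_left_Staller_ge Z_moves_subset_L_moves[OF less.prems] v(1) a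
          unfolding b_def by (meson Suc_le_lessD less_eq_Suc_le subsetD)
        moreover have "dominated G (h @ [v]) \<subseteq> dominated G (g @ [v])"
          using less.prems by auto
        ultimately have "Z.moves_left Dominator (g @ [v]) \<le> 2 * ((b + 1) div 2) - 1"
          using less.IH b_def by blast
        \<comment> \<open>The second fact covers \<open>b = 0\<close>, where the truncated bound is
          0 instead of -1.\<close>
        moreover have "(b + 1) div 2 \<le> a div 2" "1 \<le> a div 2"
          using \<open>b < a\<close> \<open>a \<ge> 2\<close> div_le_mono[of "b + 1" a 2] by simp_all
        ultimately show ?thesis using v(2) by linarith
      qed
      ultimately show ?thesis by blast
    qed
  qed
  then show "Z.moves_left Dominator g \<le> 2 * ((L.moves_left Dominator h + 1) div 2) - 1"
    and "Z.moves_left Staller g \<le> 2 * (L.moves_left Staller h div 2)"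
    by blast+
qed

text \<open>This excludes the even value 0, where truncated subtraction would spoil the parity
  argument.\<close>

lemma gamma_Zg_pos:
  assumes "pverts G \<noteq> {}"
  shows "gamma_Zg G > 0"
proof -
  obtain v where "v \<in> pverts G" using assms by blast
  then have "v \<in> Z_moves G []"
    using isolate_free by (auto simp: in_Z_moves_iff dominated_def isolate_free_def)
  then have "gamma_Zg G \<noteq> 0"
    unfolding gamma_Zg_def Z.moves_left_eq_0_iff by blast
  then show ?thesis by simp
qed

lemma gamma_Zg_le: "gamma_Zg G \<le> 2 * ((gamma_Lg G + 1) div 2) - 1"
  using Z_moves_left_le(1)[of "[]" "[]"] by (simp add: gamma_Zg_def gamma_Lg_def)

end

theorem theorem5p2:
  fixes G :: "'a pair_pre_digraph"
  assumes "pair_graph G"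
    and "pverts G \<noteq> {}"
    and "isolate_free G"
    and "even (gamma_Zg G)"
  shows "gamma_Zg G + 1 \<le> gamma_Lg G"
proof -
  have "gamma_Zg G > 0" "gamma_Zg G \<le> 2 * ((gamma_Lg G + 1) div 2) - 1"
    using gamma_Zg_pos gamma_Zg_le assms by blast+
  \<comment> \<open>The bound is positive, hence odd, so an even value lies strictly below it; and
    it is at most \<open>gamma_Lg G\<close>.\<close>
  with \<open>even (gamma_Zg G)\<close> show ?thesis by presburger
qed

end
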